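(* Let $k$ be an algebraically closed field, let $a,b\ge 2$, and let $U\subseteq R_{a,b}=H^0(\mathcal{O}_{\mathbb{P}^1\times\mathbb{P}^1}(a,b))$ be a four-dimensional basepoint free vector space with basis $\{p_0,p_1,p_2,p_3\}$. Then there is at most one linear first syzygy (up to multiplication by a nonzero scalar) on $I_U=\langle p_0,p_1,p_2,p_3\rangle$; that is, $$\dim_k \mathrm{Syz}(I_U)_{(0,1)}+\dim_k \mathrm{Syz}(I_U)_{(1,0)}\le 1 .$$
   Context: $R=k[s,t,u,v]$ is bigraded with $s,t$ of bidegree $(1,0)$ and $u,v$ of bidegree $(0,1)$; $R_{a,b}$ denotes the bidegree $(a,b)$ graded piece, identified with $H^0(\mathcal{O}_{\mathbb{P}^1\times\mathbb{P}^1}(a,b))$. $U$ is basepoint free if $p_0,\dots,p_3$ have no common zero on $\mathbb{P}^1\times\mathbb{P}^1$. First syzygies are elements of $\mathrm{Syz}(I_U)=\{(g_0,g_1,g_2,g_3)\in R^4 : \sum_{i=0}^3 g_ip_i=0\}$. A first syzygy has bidegree $(c,d)$ if all its entries $g_i$ lie in $R_{c,d}$, and $\mathrm{Syz}(I_U)_{(c,d)}$ is the $k$-vector space of first syzygies with all entries in $R_{c,d}$. A linear first syzygy is a nonzero first syzygy of bidegree $(0,1)$ or $(1,0)$. *)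

theory Defs
  imports "HOL-Analysis.Analysis" "HOL-Library.Poly_Mapping"
    "HOL-Computational_Algebra.Polynomial"
begin

text \<open>
  The ring \<open>R = k[s,t,u,v]\<close>: finitely supported maps from exponent vectors to \<open>k\<close>, with
  the convolution product that \<open>Poly_Mapping\<close> provides.
\<close>

datatype var = Vs | Vt | Vu | Vv

type_synonym 'k R = "(var \<Rightarrow>\<^sub>0 nat) \<Rightarrow>\<^sub>0 'k"

definition bigraded_piece :: "nat \<Rightarrow> nat \<Rightarrow> ('k::zero) R set"
  where "bigraded_piece a b =
    {f. \<forall>m \<in> Poly_Mapping.keys f.
          Poly_Mapping.lookup m Vs + Poly_Mapping.lookup m Vt = a \<and>
          Poly_Mapping.lookup m Vu + Poly_Mapping.lookup m Vv = b}"

definition eval_R :: "('k::comm_semiring_1) R \<Rightarrow> 'k \<Rightarrow> 'k \<Rightarrow> 'k \<Rightarrow> 'k \<Rightarrow> 'k"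
  where "eval_R f x0 x1 y0 y1 =
    (\<Sum>m \<in> Poly_Mapping.keys f. Poly_Mapping.lookup f m *
       x0 ^ Poly_Mapping.lookup m Vs * x1 ^ Poly_Mapping.lookup m Vt *
       y0 ^ Poly_Mapping.lookup m Vu * y1 ^ Poly_Mapping.lookup m Vv)"

text \<open>
  A point of \<open>\<P>\<^sup>1 \<times> \<P>\<^sup>1\<close> is given by homogeneous coordinates \<open>((x0 : x1), (y0 : y1))\<close>,
  neither pair being \<open>(0, 0)\<close>; for bihomogeneous \<open>p i\<close>, vanishing does not depend on the
  representatives.
\<close>

definition basepoint_free :: "(4 \<Rightarrow> ('k::comm_semiring_1) R) \<Rightarrow> bool"
  where "basepoint_free p \<longleftrightarrow>
    \<not> (\<exists>x0 x1 y0 y1. (x0, x1) \<noteq> (0, 0) \<and> (y0, y1) \<noteq> (0, 0) \<and>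
         (\<forall>i. eval_R (p i) x0 x1 y0 y1 = 0))"

definition scale_R :: "'k::comm_ring_1 \<Rightarrow> 'k R \<Rightarrow> 'k R"
  where "scale_R c f = Poly_Mapping.single 0 c * f"

definition scale_R4 :: "'k::comm_ring_1 \<Rightarrow> 'k R ^ 4 \<Rightarrow> 'k R ^ 4"
  where "scale_R4 c g = (\<chi> i. scale_R c (g $ i))"

lemma scale_R_simps:
  "scale_R c (f + g) = scale_R c f + scale_R c g"
  "scale_R (c + d) f = scale_R c f + scale_R d f"
  "scale_R c (scale_R d f) = scale_R (c * d) f"
  "scale_R 1 f = f"
  by (simp_all add: scale_R_def distrib_left single_add distrib_right mult_single
      flip: mult.assoc)

global_interpretation VR: vector_space "scale_R :: 'k::field \<Rightarrow> 'k R \<Rightarrow> 'k R"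
  by unfold_locales (simp_all add: scale_R_simps)

global_interpretation VR4: vector_space "scale_R4 :: 'k::field \<Rightarrow> 'k R ^ 4 \<Rightarrow> 'k R ^ 4"
  by unfold_locales (simp_all add: scale_R4_def vec_eq_iff scale_R_simps)

definition Syz :: "(4 \<Rightarrow> ('k::comm_ring_1) R) \<Rightarrow> ('k R ^ 4) set"
  where "Syz p = {g. (\<Sum>i\<in>UNIV. g $ i * p i) = 0}"

definition Syz_bideg :: "(4 \<Rightarrow> ('k::comm_ring_1) R) \<Rightarrow> nat \<Rightarrow> nat \<Rightarrow> ('k R ^ 4) set"
  where "Syz_bideg p c d = {g \<in> Syz p. \<forall>i. g $ i \<in> bigraded_piece c d}"

definition linear_first_syzygy :: "(4 \<Rightarrow> ('k::comm_ring_1) R) \<Rightarrow> 'k R ^ 4 \<Rightarrow> bool"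
  where "linear_first_syzygy p g \<longleftrightarrow>
    g \<noteq> 0 \<and> (g \<in> Syz_bideg p 0 1 \<or> g \<in> Syz_bideg p 1 0)"

end

theory Submission
  imports Defs "Jordan_Normal_Form.Determinant"
begin

text \<open>
  Write a syzygy of bidegree \<open>(0,1)\<close> as \<open>g\<^sub>i = \<alpha>\<^sub>i u + \<beta>\<^sub>i v\<close>. It says \<open>u A + v B = 0\<close> for the elements
  \<open>A = \<Sum> \<alpha>\<^sub>i p\<^sub>i\<close> and \<open>B = \<Sum> \<beta>\<^sub>i p\<^sub>i\<close> of \<open>U\<close>. Put \<open>t = v = 1\<close>, so that bihomogeneous forms become
  polynomials in \<open>x = s\<close> and \<open>y = u\<close> of bounded bidegree and \<open>U\<close> becomes a four-dimensional space
  \<open>W\<close>: the equation is \<open>B = - y A\<close>. A syzygy of bidegree \<open>(0,1)\<close> is thus the same thing as an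
  \<open>A \<in> W\<close> with \<open>y A \<in> W\<close>, and one of bidegree \<open>(1,0)\<close> is a \<open>B \<in> W\<close> with \<open>x B \<in> W\<close>. The membership
  \<open>y A \<in> W\<close> also shows that \<open>A\<close> has bidegree \<open>(a, b - 1)\<close>, one less than expected.

  What contradicts base point freeness is Bezout's theorem on \<open>\<P>\<^sup>1 \<times> \<P>\<^sup>1\<close> in its weakest form
  (\<open>bihomogeneous_common_zero\<close>): forms of bidegrees \<open>(c,d)\<close> and \<open>(c',d')\<close> with \<open>c d' + c' d > 0\<close>
  have a common zero. Their Sylvester determinant with respect to the second factor is a binary
  form of degree \<open>c d' + c' d\<close> on the first one, so it has a zero there, and over this zero the two
  restricted forms meet. Consequently \<open>W\<close> cannot lie in the ideal of two such forms
  (\<open>not_generated_by_two_forms\<close>). In particular \<open>W\<close> has no three-dimensional subspace of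
  multiples of a single \<open>h\<close> of bidegree other than \<open>(0,0)\<close>: \<open>h\<close> and a fourth basis vector would generate
  everything (\<open>no_three_multiples\<close>).

  Let \<open>A\<close>, \<open>B\<close> come from two non-proportional syzygies of bidegree \<open>(0,1)\<close>. If \<open>A, yA, B, yB\<close>
  are independent, they span \<open>W\<close>, which then lies in the ideal of \<open>A\<close> and \<open>B\<close>. Otherwise a relation
  \<open>(c\<^sub>0 A + c\<^sub>2 B) + y (c\<^sub>1 A + c\<^sub>3 B) = 0\<close> makes \<open>H = c\<^sub>1 A + c\<^sub>3 B\<close> an element with
  \<open>H, yH, y\<^sup>2H \<in> W\<close>, three multiples of \<open>H\<close>; here \<open>H \<noteq> 0\<close> since \<open>A\<close> and \<open>B\<close> are not
  proportional. If the syzygies have bidegrees \<open>(0,1)\<close> and \<open>(1,0)\<close>, then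
  \<open>A, yA, B, xB\<close> independent is excluded in the same way, and a relation reads \<open>m(y) A = - l(x) B\<close>
  with linear \<open>l\<close>, \<open>m\<close>. Being coprime, these divide \<open>B = m h\<close> and \<open>A = - l h\<close>, and again \<open>W\<close>
  contains three independent multiples of \<open>h\<close>. Two syzygies of bidegree \<open>(1,0)\<close> are the first case
  with the two factors of \<open>\<P>\<^sup>1 \<times> \<P>\<^sup>1\<close> exchanged.
\<close>

(* From here on smult is scalar multiplication of polynomials, not that of modules over carriers. *)
hide_const (open) Module.smult

section \<open>Binary forms and their zeros on the projective line\<close>

text \<open>
  A polynomial \<open>f\<close> of degree at most \<open>n\<close> stands for the binary form of degree \<open>n\<close> that it
  dehomogenises. Points of \<open>\<P>\<^sup>1\<close> are options: \<open>Some x\<close> is \<open>(x : 1)\<close> and \<open>None\<close> is \<open>(1 : 0)\<close>, where the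
  value of the form is its coefficient of degree \<open>n\<close>. The degree \<open>n\<close> has to be given, since \<open>f\<close> does not
  determine it.
\<close>

definition form_val :: "nat \<Rightarrow> 'a::comm_semiring_0 poly \<Rightarrow> 'a option \<Rightarrow> 'a"
  where "form_val n f z = (case z of None \<Rightarrow> coeff f n | Some x \<Rightarrow> poly f x)"

lemma form_val_0 [simp]: "form_val n 0 z = 0"
  by (simp add: form_val_def split: option.split)

lemma form_val_add: "form_val n (f + g) z = form_val n f z + form_val n g z"
  by (simp add: form_val_def split: option.split)

lemma form_val_sum: "form_val n (\<Sum>i\<in>I. f i) z = (\<Sum>i\<in>I. form_val n (f i) z)"
  by (induction I rule: infinite_finite_induct) (simp_all add: form_val_add)

lemma form_val_smult: "form_val n (smult c f) z = c * form_val n f z"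
  by (simp add: form_val_def split: option.split)

lemma coeff_mult_at_degree_bounds:
  fixes f g :: "'a::comm_semiring_0 poly"
  assumes "degree f \<le> m" "degree g \<le> n"
  shows "coeff (f * g) (m + n) = coeff f m * coeff g n"
proof -
  have "coeff f i * coeff g (m + n - i) = 0" if "i \<noteq> m" for i
  proof (cases "i < m")
    case True
    then have "degree g < m + n - i" using assms by simp
    then show ?thesis by (simp add: coeff_eq_0)
  next
    case False
    then have "degree f < i" using that assms by simp
    then show ?thesis by (simp add: coeff_eq_0)
  qed
  then have "(\<Sum>i\<le>m + n. coeff f i * coeff g (m + n - i)) = (\<Sum>i\<in>{m}. coeff f i * coeff g (m + n - i))"
    by (intro sum.mono_neutral_right) auto
  then show ?thesis by (simp add: coeff_mult)
qed

lemma form_val_mult: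
  assumes "degree f \<le> m" "degree g \<le> n"
  shows "form_val (m + n) (f * g) z = form_val m f z * form_val n g z"
  using coeff_mult_at_degree_bounds[OF assms] by (simp add: form_val_def split: option.split)

lemma form_val_prod:
  fixes f :: "'i \<Rightarrow> 'a::comm_semiring_1 poly"
  assumes "\<And>i. i \<in> I \<Longrightarrow> degree (f i) \<le> n i"
  shows "form_val (\<Sum>i\<in>I. n i) (\<Prod>i\<in>I. f i) z = (\<Prod>i\<in>I. form_val (n i) (f i) z)"
    and "degree (\<Prod>i\<in>I. f i) \<le> (\<Sum>i\<in>I. n i)"
proof -
  have "form_val (\<Sum>i\<in>I. n i) (\<Prod>i\<in>I. f i) z = (\<Prod>i\<in>I. form_val (n i) (f i) z) \<and>
    degree (\<Prod>i\<in>I. f i) \<le> (\<Sum>i\<in>I. n i)"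
    using assms
  proof (induction I rule: infinite_finite_induct)
    case (insert i I)
    then have "degree (f i) \<le> n i" "degree (\<Prod>i\<in>I. f i) \<le> (\<Sum>i\<in>I. n i)" by auto
    then show ?case
      using insert by (simp add: form_val_mult order_trans[OF degree_mult_le] add_mono)
  qed (simp_all add: form_val_def split: option.split)
  then show "form_val (\<Sum>i\<in>I. n i) (\<Prod>i\<in>I. f i) z = (\<Prod>i\<in>I. form_val (n i) (f i) z)"
    and "degree (\<Prod>i\<in>I. f i) \<le> (\<Sum>i\<in>I. n i)" by auto
qed

lemma form_has_zero:
  fixes f :: "'a::alg_closed_field poly"
  assumes "n > 0" "degree f \<le> n"
  shows "\<exists>z. form_val n f z = 0"
proof (cases "coeff f n = 0")
  case True
  then show ?thesis by (intro exI[of _ None]) (simp add: form_val_def)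
next
  case False
  then have "degree f > 0" using assms le_degree by (metis le_0_eq neq0_conv)
  then obtain x where "poly f x = 0" using alg_closed_imp_poly_has_root by blast
  then show ?thesis by (intro exI[of _ "Some x"]) (simp add: form_val_def)
qed

text \<open>
  Over an algebraically closed field, polynomials without common roots are coprime; splitting off the
  roots of \<open>g\<close> one at a time gives the divisibility that coprimality is needed for.
\<close>

lemma dvd_mult_cancel_no_common_root:
  fixes f g h :: "'a::alg_closed_field poly"
  assumes "g dvd h * f" "g \<noteq> 0" "\<And>x. poly g x = 0 \<Longrightarrow> poly f x \<noteq> 0"
  shows "g dvd h"
  using assms
proof (induction "degree g" arbitrary: g h)
  case 0
  then show ?case using is_unit_iff_degree by (metis unit_imp_dvd)
next
  case (Suc n)
  then obtain z where z: "poly g z = 0" using alg_closed_imp_poly_has_root by force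
  then obtain g' where g': "g = [:-z, 1:] * g'" by (auto simp: poly_eq_0_iff_dvd)
  obtain k where "h * f = g * k" using Suc.prems(1) by (auto simp: dvd_def)
  then have "poly (h * f) z = 0" using z by simp
  then have "poly h z = 0" using Suc.prems(3) z by simp
  then obtain h' where h': "h = [:-z, 1:] * h'" by (auto simp: poly_eq_0_iff_dvd)
  have nz: "g' \<noteq> 0" using Suc.prems(2) g' by auto
  have "Suc n = 1 + degree g'" unfolding Suc.hyps(2) g' by (subst degree_mult_eq) (use nz in auto)
  then have n: "n = degree g'" by simp
  have dvd: "g' dvd h' * f"
  proof -
    have "[:-z, 1:] * g' dvd [:-z, 1:] * (h' * f)" using Suc.prems(1) unfolding g' h' by (simp only: mult.assoc)
    then show ?thesis by (subst (asm) dvd_mult_cancel_left) simp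
  qed
  have "poly f x \<noteq> 0" if "poly g' x = 0" for x
    using that Suc.prems(3)[of x] unfolding g' by simp
  with n dvd nz have "g' dvd h'" by (rule Suc.hyps(1))
  then show ?case unfolding g' h' by (rule mult_dvd_mono[OF dvd_refl])
qed

text \<open>
  The nontrivial half of the resultant criterion at finite points: \<open>g\<close> divides the cofactor \<open>A\<close>, whose
  degree is too small. The condition on the leading coefficient of \<open>g\<close> keeps the point at infinity
  from being a zero of \<open>g\<close>.
\<close>

lemma cofactor_zero_of_no_common_root:
  fixes f g A B :: "'a::alg_closed_field poly"
  assumes "A * f + B * g = 0" "degree g \<le> n" "coeff g n \<noteq> 0" "\<And>i. n \<le> i \<Longrightarrow> coeff A i = 0"
    and "\<And>x. poly g x = 0 \<Longrightarrow> poly f x \<noteq> 0"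
  shows "A = 0 \<and> B = 0"
proof -
  have g0: "g \<noteq> 0" using assms by auto
  have "A * f = g * (- B)" using assms(1) by (simp add: add_eq_0_iff mult.commute)
  then have "g dvd A" using assms g0 dvd_mult_cancel_no_common_root[of g A f] by auto
  moreover have "degree g = n" using assms(2,3) le_degree by (metis le_antisym)
  ultimately have "A = 0" using assms(4)[of "degree A"] dvd_imp_degree_le[of g A] by (metis leading_coeff_0_iff)
  then show ?thesis using assms(1) g0 by simp
qed

text \<open>
  A linear relation between the columns of the Sylvester matrix forces a common zero on \<open>\<P>\<^sup>1\<close>. If
  infinity is not one, then one of the two forms has full degree, and the previous lemma applies with
  that form in the role of \<open>g\<close>.
\<close>

lemma common_zero_of_forms:
  fixes f g A B :: "'a::alg_closed_field poly"
  assumes rel: "A * f + B * g = 0" and nz: "A \<noteq> 0 \<or> B \<noteq> 0"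
    and "degree f \<le> m" "degree g \<le> n"
    and "\<And>i. n \<le> i \<Longrightarrow> coeff A i = 0" "\<And>i. m \<le> i \<Longrightarrow> coeff B i = 0"
  shows "\<exists>z. form_val m f z = 0 \<and> form_val n g z = 0"
proof (rule ccontr)
  assume no: "\<not> ?thesis"
  have "coeff f m \<noteq> 0 \<or> coeff g n \<noteq> 0"
    using no by (auto simp: form_val_def dest: spec[of _ None])
  moreover have r: "poly f x \<noteq> 0 \<or> poly g x \<noteq> 0" for x
    using no by (auto simp: form_val_def dest: spec[of _ "Some x"])
  moreover have "B * g + A * f = 0" using rel by (simp add: add.commute)
  ultimately show False
    using cofactor_zero_of_no_common_root[of A f B g n] cofactor_zero_of_no_common_root[of B g A f m]
      assms by blast
qed

section \<open>Common zeros of bihomogeneous forms\<close>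

text \<open>
  An iterated polynomial is read as a polynomial in \<open>y\<close> with coefficients in \<open>k[x]\<close>; it represents a form of
  bidegree \<open>(c, d)\<close> when its degrees in \<open>x\<close> and \<open>y\<close> are at most \<open>c\<close> and \<open>d\<close>.
\<close>

definition bideg_le :: "nat \<Rightarrow> nat \<Rightarrow> 'a::zero poly poly \<Rightarrow> bool"
  where "bideg_le c d F \<longleftrightarrow> degree F \<le> d \<and> (\<forall>j. degree (coeff F j) \<le> c)"

definition biform_val ::
    "nat \<Rightarrow> nat \<Rightarrow> 'a::comm_semiring_0 poly poly \<Rightarrow> 'a option \<Rightarrow> 'a option \<Rightarrow> 'a"
  where "biform_val c d F x y = form_val d (map_poly (\<lambda>f. form_val c f x) F) y"

lemma biform_val_0 [simp]: "biform_val c d 0 x y = 0"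
  by (simp add: biform_val_def)

lemma biform_val_add: "biform_val c d (F + G) x y = biform_val c d F x y + biform_val c d G x y"
proof -
  have "map_poly (\<lambda>f. form_val c f x) (F + G) =
      map_poly (\<lambda>f. form_val c f x) F + map_poly (\<lambda>f. form_val c f x) G"
    by (intro poly_eqI) (simp add: coeff_map_poly form_val_add)
  then show ?thesis by (simp add: biform_val_def form_val_add)
qed

lemma biform_val_sum: "biform_val c d (\<Sum>i\<in>I. F i) x y = (\<Sum>i\<in>I. biform_val c d (F i) x y)"
  by (induction I rule: infinite_finite_induct) (simp_all add: biform_val_add)

lemma biform_val_scale: 
  "biform_val c d (smult [:k:] F) x y = k * biform_val c d F x y"
proof -
  have "map_poly (\<lambda>f. form_val c f x) (smult [:k:] F) = smult k (map_poly (\<lambda>f. form_val c f x) F)"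
    by (intro poly_eqI) (simp add: coeff_map_poly form_val_smult)
  then show ?thesis by (simp add: biform_val_def form_val_smult)
qed

lemma degree_map_form_val: "bideg_le c d F \<Longrightarrow> degree (map_poly (\<lambda>f. form_val c f x) F) \<le> d"
  by (auto simp: bideg_le_def coeff_map_poly coeff_eq_0 intro!: degree_le)

lemma biform_val_mult:
  assumes "bideg_le c d F" "bideg_le c' d' G"
  shows "biform_val (c + c') (d + d') (F * G) x y = biform_val c d F x y * biform_val c' d' G x y"
proof -
  have "map_poly (\<lambda>f. form_val (c + c') f x) (F * G) =
      map_poly (\<lambda>f. form_val c f x) F * map_poly (\<lambda>f. form_val c' f x) G"
    using assms
    by (intro poly_eqI) (simp add: coeff_map_poly coeff_mult form_val_sum form_val_mult bideg_le_def)
  then show ?thesis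
    using form_val_mult[OF degree_map_form_val[OF assms(1)] degree_map_form_val[OF assms(2)]]
    by (simp add: biform_val_def)
qed

lemma sum_lessThan_add:
  fixes f :: "nat \<Rightarrow> 'a::comm_monoid_add"
  shows "(\<Sum>i<m + n. f i) = (\<Sum>i<m. f i) + (\<Sum>i<n. f (m + i))"
  by (induction n) (simp_all add: add.assoc)

text \<open>
  The Sylvester matrix of \<open>F\<close> and \<open>G\<close> in the variable \<open>y\<close> has \<open>d'\<close> columns with entries of degree at
  most \<open>c\<close> and \<open>d\<close> columns with entries of degree at most \<open>c'\<close>, so its determinant is a binary form of
  degree \<open>c d' + c' d\<close> in \<open>x\<close>. At a zero of this form the specialised matrix has a kernel, which is
  a relation between the specialisations of \<open>F\<close> and \<open>G\<close>.
\<close>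

lemma bihomogeneous_common_zero:
  fixes F G :: "'a::alg_closed_field poly poly"
  assumes F: "bideg_le c d F" and G: "bideg_le c' d' G" and pos: "0 < c * d' + c' * d"
  shows "\<exists>x y. biform_val c d F x y = 0 \<and> biform_val c' d' G x y = 0"
proof -
  define N where "N = d' + d"
  define w where "w r = (if r < d' then c else c')" for r
  define col where "col r = (if r < d' then monom 1 r * F else monom 1 (r - d') * G)" for r
  define S where "S = Matrix.mat N N (\<lambda>(i, r). coeff (col r) i)"
  define n where "n = (\<Sum>r<N. w r)"
  have S: "S \<in> carrier_mat N N" by (simp add: S_def)
  have n: "n = c * d' + c' * d"
    unfolding n_def N_def by (simp add: sum_lessThan_add w_def)
  have deg: "degree (S $$ (i, r)) \<le> w r" if "i < N" "r < N" for i r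
    using that F G by (auto simp: S_def col_def w_def coeff_monom_mult bideg_le_def)
  have detS: "Determinant.det S = (\<Sum>p | p permutes {0..<N}. signof p * (\<Prod>r<N. S $$ (p r, r)))"
    by (rule det_col[OF S])
  have perm: "p r < N" if "p permutes {0..<N}" "r < N" for p r
    using permutes_in_image[OF that(1), of r] that(2) by simp
  have sgn: "(signof p :: 'a poly) = [:signof p:]" for p :: "nat \<Rightarrow> nat"
    by (simp add: sign_def one_pCons)
  have "degree (Determinant.det S) \<le> n"
    unfolding detS
  proof (rule degree_sum_le)
    show "finite {p. p permutes {0..<N}}" by (simp add: finite_permutations)
    fix p assume "p \<in> {p. p permutes {0..<N}}"
    then have "degree (\<Prod>r<N. S $$ (p r, r)) \<le> n"
      unfolding n_def using perm deg by (intro form_val_prod(2)) auto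
    then show "degree (signof p * (\<Prod>r<N. S $$ (p r, r))) \<le> n" by (simp add: sgn order_trans[OF degree_smult_le])
  qed
  then obtain x where x: "form_val n (Determinant.det S) x = 0"
    using form_has_zero pos n by metis
  \<comment> \<open>Taking values of forms commutes with products and sums, hence with the determinant, as long as
    each entry is read as a form of the degree \<open>w\<close> that belongs to its column.\<close>
  define Fx where "Fx = map_poly (\<lambda>f. form_val c f x) F"
  define Gx where "Gx = map_poly (\<lambda>f. form_val c' f x) G"
  define T where "T = Matrix.mat N N (\<lambda>(i, r). form_val (w r) (S $$ (i, r)) x)"
  have T: "T \<in> carrier_mat N N" by (simp add: T_def)
  have Tir: "T $$ (i, r) = coeff (if r < d' then monom 1 r * Fx else monom 1 (r - d') * Gx) i"
    if "i < N" "r < N" for i r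
    using that by (simp add: T_def S_def col_def w_def Fx_def Gx_def coeff_monom_mult coeff_map_poly)
  have "Determinant.det T = form_val n (Determinant.det S) x"
    unfolding detS det_col[OF T] form_val_sum
  proof (rule sum.cong)
    fix p assume p: "p \<in> {p. p permutes {0..<N}}"
    then have "form_val n (\<Prod>r<N. S $$ (p r, r)) x = (\<Prod>r<N. form_val (w r) (S $$ (p r, r)) x)"
      unfolding n_def using perm deg by (intro form_val_prod(1)) auto
    also have "\<dots> = (\<Prod>r<N. T $$ (p r, r))"
      using perm p by (intro prod.cong) (auto simp: T_def)
    finally show "signof p * (\<Prod>r<N. T $$ (p r, r)) = form_val n (signof p * (\<Prod>r<N. S $$ (p r, r))) x"
      by (simp add: sgn form_val_smult)
  qed simp
  then obtain v where v: "v \<in> carrier_vec N" "v \<noteq> 0\<^sub>v N" "T *\<^sub>v v = 0\<^sub>v N"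
    using x det_0_iff_vec_prod_zero_field[OF T] by auto
  \<comment> \<open>The kernel vector consists of the coefficients of the two cofactors.\<close>
  define A where "A = (\<Sum>r<d'. monom (vec_index v r) r)"
  define B where "B = (\<Sum>r<d. monom (vec_index v (d' + r)) r)"
  have coeffA: "coeff A i = (if i < d' then vec_index v i else 0)" for i
    by (simp add: A_def coeff_sum)
  have coeffB: "coeff B i = (if i < d then vec_index v (d' + i) else 0)" for i
    by (simp add: B_def coeff_sum)
  have "A * Fx + B * Gx = 0"
  proof (rule poly_eqI)
    fix i
    show "coeff (A * Fx + B * Gx) i = coeff 0 i"
    proof (cases "i < N")
      case True
      have "0 = vec_index (T *\<^sub>v v) i" using v True by simp
      also have "\<dots> = (\<Sum>r<N. T $$ (i, r) * vec_index v r)"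
        using T True v(1) by (simp add: scalar_prod_def lessThan_atLeast0 carrier_vecD)
      also have "\<dots> = (\<Sum>r<N. coeff (if r < d' then monom 1 r * Fx else monom 1 (r - d') * Gx) i * vec_index v r)"
        using True by (intro sum.cong) (auto simp: Tir)
      also have "\<dots> = (\<Sum>r<d'. coeff (monom 1 r * Fx) i * vec_index v r)
          + (\<Sum>r<d. coeff (monom 1 r * Gx) i * vec_index v (d' + r))"
        unfolding N_def by (simp add: sum_lessThan_add)
      also have "\<dots> = coeff (A * Fx + B * Gx) i"
      proof -
        have "coeff (monom (vec_index v k) r * f) i = coeff (monom 1 r * f) i * vec_index v k"
          for k r and f :: "'a poly"
          by (simp add: coeff_monom_mult)
        then show ?thesis by (simp only: A_def B_def sum_distrib_right coeff_sum coeff_add)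
      qed
      finally show ?thesis by simp
    next
      case False
      have "degree Fx \<le> d" "degree Gx \<le> d'"
        unfolding Fx_def Gx_def using F G degree_map_form_val by blast+
      moreover have "A = 0 \<or> degree A < d'" "B = 0 \<or> degree B < d"
        using coeffA[of "degree A"] coeffB[of "degree B"] by (auto split: if_splits)
      moreover have "i \<ge> d' + d" using False by (simp add: N_def)
      ultimately have "A = 0 \<or> degree (A * Fx) < i" "B = 0 \<or> degree (B * Gx) < i"
        using degree_mult_le[of A Fx] degree_mult_le[of B Gx] by linarith+
      then have "coeff (A * Fx) i = 0" "coeff (B * Gx) i = 0" by (auto simp: coeff_eq_0)
      then show ?thesis by simp
    qed
  qed
  moreover have "A \<noteq> 0 \<or> B \<noteq> 0"
  proof -
    obtain r where r: "r < N" "vec_index v r \<noteq> 0"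
      using v(1,2) by (metis eq_vecI carrier_vecD index_zero_vec)
    then show ?thesis
      using coeffA[of r] coeffB[of "r - d'"] by (cases "r < d'") (auto simp: N_def split: if_splits)
  qed
  ultimately obtain y where "form_val d Fx y = 0" "form_val d' Gx y = 0"
    using common_zero_of_forms[of A Fx B Gx d d'] coeffA coeffB F G degree_map_form_val
    unfolding Fx_def Gx_def by (metis not_le)
  then show ?thesis by (auto simp: biform_val_def Fx_def Gx_def)
qed

section \<open>Linear algebra with few vectors\<close>

context vector_space begin

lemma independent_family:
  assumes fin: "finite I" and rel: "\<And>c. (\<Sum>i\<in>I. scale (c i) (w i)) = 0 \<Longrightarrow> \<forall>i\<in>I. c i = 0"
  shows "inj_on w I" "independent (w ` I)"
proof -
  show inj: "inj_on w I"
  proof (rule inj_onI, rule ccontr)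
    fix i j assume ij: "i \<in> I" "j \<in> I" "w i = w j" "i \<noteq> j"
    define c where "c k = (if k = i then 1 else if k = j then - 1 else 0 :: 'a)" for k
    have "(\<Sum>k\<in>I. scale (c k) (w k)) = (\<Sum>k\<in>{i, j}. scale (c k) (w k))"
      using ij fin by (intro sum.mono_neutral_right) (auto simp: c_def)
    also have "\<dots> = 0" using ij by (simp add: c_def)
    finally have "c i = 0" using rel ij(1) by blast
    then show False by (simp add: c_def)
  qed
  show "independent (w ` I)"
  proof
    assume "dependent (w ` I)"
    then obtain u where u: "\<exists>v\<in>w ` I. u v \<noteq> 0" "(\<Sum>v\<in>w ` I. scale (u v) v) = 0"
      using fin by (auto simp: dependent_finite)
    then have "(\<Sum>i\<in>I. scale (u (w i)) (w i)) = 0" by (simp add: sum.reindex[OF inj])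
    then show False using rel[of "\<lambda>i. u (w i)"] u(1) by blast
  qed
qed

lemma independent_three:
  assumes "\<And>c0 c1 c2. scale c0 u + scale c1 v + scale c2 w = 0 \<Longrightarrow> c0 = 0 \<and> c1 = 0 \<and> c2 = 0"
  shows "independent {u, v, w}" "card {u, v, w} = 3"
proof -
  have set3: "{..<3::nat} = {0, 1, 2}" by auto
  have rel: "\<forall>i\<in>{..<3::nat}. c i = 0" if "(\<Sum>i<3. scale (c i) ([u, v, w] ! i)) = 0" for c
    using assms[of "c 0" "c 1" "c 2"] that by (simp add: set3 add.assoc)
  note fam = independent_family[of "{..<3}" "(!) [u, v, w]", OF finite_lessThan rel]
  have im: "(!) [u, v, w] ` {..<3::nat} = {u, v, w}" by (auto simp: set3)
  show "independent {u, v, w}" using fam(2) im by simp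
  show "card {u, v, w} = 3" using card_image[OF fam(1)] im by simp
qed

lemma independent_four:
  assumes "\<And>c0 c1 c2 c3. scale c0 u + scale c1 v + scale c2 w + scale c3 z = 0
    \<Longrightarrow> c0 = 0 \<and> c1 = 0 \<and> c2 = 0 \<and> c3 = 0"
  shows "independent {u, v, w, z}" "card {u, v, w, z} = 4"
proof -
  have set4: "{..<4::nat} = {0, 1, 2, 3}" by auto
  have rel: "\<forall>i\<in>{..<4::nat}. c i = 0" if "(\<Sum>i<4. scale (c i) ([u, v, w, z] ! i)) = 0" for c
    using assms[of "c 0" "c 1" "c 2" "c 3"] that by (simp add: set4 add.assoc)
  note fam = independent_family[of "{..<4}" "(!) [u, v, w, z]", OF finite_lessThan rel]
  have im: "(!) [u, v, w, z] ` {..<4::nat} = {u, v, w, z}" by (auto simp: set4)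
  show "independent {u, v, w, z}" using fam(2) im by simp
  show "card {u, v, w, z} = 4" using card_image[OF fam(1)] im by simp
qed

lemma spanned_by_independent_of_full_card:
  assumes "independent S" "S \<subseteq> span T" "finite T" "card T \<le> card S"
  shows "T \<subseteq> span S"
proof
  fix t assume t: "t \<in> T"
  show "t \<in> span S"
  proof (rule ccontr)
    assume nt: "t \<notin> span S"
    then have "independent (insert t S)" using assms(1) by (rule independent_insertI)
    moreover have "insert t S \<subseteq> span T" using assms(2) t by (auto intro: span_base)
    ultimately have "finite (insert t S)" "card (insert t S) \<le> card T"
      using independent_span_bound[OF assms(3), of "insert t S"] by simp_all
    moreover have "t \<notin> S" using nt span_base by blast
    ultimately show False using assms(4) by simp
  qed
qed

text \<open>
  The common zero argument works with two forms, so three multiples of one form have to be completed to a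
  spanning set by a single vector.
\<close>

lemma spanned_by_one_more:
  assumes S: "independent S" "S \<subseteq> span T" and T: "independent T" "card T = Suc (card S)"
  obtains f where "f \<in> T" "T \<subseteq> span (insert f S)"
proof -
  have fT: "finite T" using T(2) card.infinite by force
  have fS: "finite S" using independent_span_bound[OF fT S] by blast
  have "\<not> T \<subseteq> span S" using independent_span_bound[OF fS T(1)] T(2) by auto
  then obtain f where f: "f \<in> T" "f \<notin> span S" by blast
  have "independent (insert f S)" using f(2) S(1) by (rule independent_insertI)
  moreover have "insert f S \<subseteq> span T" using S(2) f(1) by (auto intro: span_base)
  moreover have "f \<notin> S" using f(2) span_base by blast
  ultimately have "T \<subseteq> span (insert f S)"
    using spanned_by_independent_of_full_card fT fS T(2) by simp
  with f(1) show thesis by (rule that)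
qed

end

section \<open>Spaces of dehomogenised forms\<close>

definition pscale :: "'k::comm_ring_1 \<Rightarrow> 'k poly poly \<Rightarrow> 'k poly poly"
  where "pscale k F = smult [:k:] F"

global_interpretation PP: vector_space "pscale :: 'k::field \<Rightarrow> 'k poly poly \<Rightarrow> 'k poly poly"
  by unfold_locales
    (simp_all add: pscale_def smult_add_right smult_add_left[symmetric] mult.commute flip: one_pCons)

lemma bideg_le_0 [simp]: "bideg_le c d 0"
  by (simp add: bideg_le_def)

lemma bideg_le_add: "bideg_le c d F \<Longrightarrow> bideg_le c d G \<Longrightarrow> bideg_le c d (F + G)"
  by (simp add: bideg_le_def degree_add_le)

lemma bideg_le_pscale: "bideg_le c d F \<Longrightarrow> bideg_le c d (pscale k F)"
  unfolding bideg_le_def pscale_def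
  by (auto intro: order_trans[OF degree_smult_le])

lemma bideg_le_pCons [simp]:
  "bideg_le c (Suc d) (pCons f F) \<longleftrightarrow> degree f \<le> c \<and> bideg_le c d F"
  by (auto simp: bideg_le_def coeff_pCons split: nat.splits if_splits)

lemma bideg_le_const [simp]: "bideg_le c d [:f:] \<longleftrightarrow> degree f \<le> c"
  by (auto simp: bideg_le_def coeff_pCons split: nat.splits)

lemma bideg_le_y_multiple: "0 < d \<Longrightarrow> bideg_le c d (pCons 0 F) \<Longrightarrow> bideg_le c (d - 1) F"
  by (cases d) simp_all

lemma bideg_le_x_multiple:
  assumes "bideg_le c d (smult [:0, 1:] (F :: 'k::field poly poly))"
  shows "bideg_le (c - 1) d F"
proof -
  have "degree (coeff F j) \<le> c - 1" for j
  proof (cases "coeff F j = 0")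
    case False
    have "degree ([:0, 1:] * coeff F j) \<le> c" using assms by (simp only: bideg_le_def coeff_smult) 
    then show ?thesis using False by (simp add: degree_pCons_eq)
  qed simp
  then show ?thesis using assms by (simp add: bideg_le_def)
qed

text \<open>
  The degree in \<open>x\<close> of a product with a nonzero polynomial in \<open>y\<close> alone is that of the other factor. For a linear
  polynomial this follows by comparing coefficients upwards from the constant one; it is used to bound a
  quotient.
\<close>

lemma degree_coeffs_linear_y_factor:
  fixes h :: "'k::field poly poly"
  assumes nz: "c0 \<noteq> 0 \<or> c1 \<noteq> 0" and deg: "\<And>j. degree (coeff ([:[:c0:], [:c1:]:] * h) j) \<le> n"
  shows "degree (coeff h j) \<le> n"
proof -
  have expand: "coeff ([:[:c0:], [:c1:]:] * h) j =
      smult c0 (coeff h j) + (case j of 0 \<Rightarrow> 0 | Suc i \<Rightarrow> smult c1 (coeff h i))" for j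
    by (simp add: coeff_pCons split: nat.split)
  show ?thesis
  proof (cases "c0 = 0")
    case True
    then show ?thesis using nz deg[of "Suc j"] expand[of "Suc j"] by simp
  next
    case False
    show ?thesis
    proof (induction j)
      case 0
      then show ?case using False deg[of 0] expand[of 0] by simp
    next
      case (Suc i)
      have "smult c0 (coeff h (Suc i)) =
          coeff ([:[:c0:], [:c1:]:] * h) (Suc i) - smult c1 (coeff h i)"
        using expand[of "Suc i"] by simp
      also have "degree \<dots> \<le> n"
        by (intro degree_diff_le deg order_trans[OF degree_smult_le Suc])
      finally have "degree (smult c0 (coeff h (Suc i))) \<le> n" .
      then show ?case using False by simp
    qed
  qed
qed

section \<open>Base point free four-dimensional spaces\<close>

text \<open>
  A basis of a four-dimensional space of forms of bidegree \<open>(a, b)\<close> without base points, dehomogenised.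
\<close>

locale bpf_quadruple =
  fixes a b :: nat and T :: "'k::alg_closed_field poly poly set"
  assumes a: "2 \<le> a" and b: "2 \<le> b"
    and indep: "PP.independent T" and card: "card T = 4"
    and bideg: "\<And>t. t \<in> T \<Longrightarrow> bideg_le a b t"
    and bpf: "\<And>x y. \<exists>t\<in>T. biform_val a b t x y \<noteq> 0"
begin

abbreviation W where "W \<equiv> PP.span T"

lemma finite_T: "finite T"
  using card card.infinite by force

lemma bideg_W: "f \<in> W \<Longrightarrow> bideg_le a b f"
proof -
  have "PP.subspace {f. bideg_le a b f}"
    by (auto intro!: PP.subspaceI bideg_le_add bideg_le_pscale)
  then have "W \<subseteq> {f. bideg_le a b f}"
    using bideg by (intro PP.span_minimal) auto
  then show "f \<in> W \<Longrightarrow> bideg_le a b f" by auto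
qed

text \<open>
  A common zero of \<open>F\<close> and \<open>G\<close> would be a base point. The conditions on \<open>e\<close> and \<open>e'\<close> make \<open>e F\<close> and
  \<open>e' G\<close> products of forms, which is what carries the argument through at infinity.
\<close>

lemma not_generated_by_two_forms:
  assumes T: "T \<subseteq> PP.span S"
    and F: "bideg_le c d F" "c \<le> a" "d \<le> b" and G: "bideg_le c' d' G" "c' \<le> a" "d' \<le> b"
    and pos: "0 < c * d' + c' * d"
    and gen: "\<And>s. s \<in> S \<Longrightarrow> \<exists>e e'. bideg_le (a - c) (b - d) e \<and> bideg_le (a - c') (b - d') e' \<and>
      s = e * F + e' * G"
  shows False
proof -
  obtain x y where 0: "biform_val c d F x y = 0" "biform_val c' d' G x y = 0"
    using bihomogeneous_common_zero[OF F(1) G(1) pos] by blast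
  have "biform_val a b s x y = 0" if s: "s \<in> S" for s
  proof -
    obtain e e' where e: "bideg_le (a - c) (b - d) e" "bideg_le (a - c') (b - d') e'"
      "s = e * F + e' * G" using gen[OF s] by blast
    have "biform_val a b (e * F) x y = 0"
      using biform_val_mult[OF e(1) F(1), of x y] F 0 by simp
    moreover have "biform_val a b (e' * G) x y = 0"
      using biform_val_mult[OF e(2) G(1), of x y] G 0 by simp
    ultimately show ?thesis using e(3) by (simp add: biform_val_add)
  qed
  moreover have "PP.subspace {f. biform_val a b f x y = 0}"
    by (intro PP.subspaceI) (auto simp: biform_val_add biform_val_scale pscale_def)
  ultimately have "PP.span S \<subseteq> {f. biform_val a b f x y = 0}"
    by (intro PP.span_minimal) auto
  then show False using T bpf[of x y] by auto
qed

text \<open>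
  Three independent multiples of \<open>h\<close> together with one further basis vector \<open>f\<close> span everything, so \<open>W\<close>
  would lie in the ideal of \<open>h\<close> and \<open>f\<close>.
\<close>

lemma no_three_multiples:
  assumes S: "PP.independent S" "card S = 3" "S \<subseteq> W"
    and h: "bideg_le c d h" "c \<le> a" "d \<le> b" and pos: "0 < c * b + a * d"
    and mult: "\<And>s. s \<in> S \<Longrightarrow> \<exists>e. bideg_le (a - c) (b - d) e \<and> s = e * h"
  shows False
proof -
  obtain f where f: "f \<in> T" "T \<subseteq> PP.span (insert f S)"
    using PP.spanned_by_one_more[OF S(1,3) indep] S(2) card by auto
  show False
  proof (rule not_generated_by_two_forms[OF f(2) h bideg[OF f(1)] order_refl order_refl pos])
    fix s assume "s \<in> insert f S"
    then consider "s = 0 * h + 1 * f" | e where "bideg_le (a - c) (b - d) e" "s = e * h + 0 * f"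
      using mult by fastforce
    then show "\<exists>e e'. bideg_le (a - c) (b - d) e \<and> bideg_le (a - a) (b - b) e' \<and> s = e * h + e' * f"
    proof cases
      case 1
      moreover have "bideg_le (a - a) (b - b) (1 :: 'k poly poly)" by (simp add: bideg_le_def)
      ultimately show ?thesis using bideg_le_0 by blast
    next
      case 2
      then show ?thesis using bideg_le_0 by blast
    qed
  qed
qed

text \<open>
  Uniqueness for syzygies of bidegree \<open>(0,1)\<close>. Either the four elements span \<open>W\<close>, and the forms \<open>A\<close>
  and \<open>B\<close> of bidegree \<open>(a, b - 1)\<close> generate it, or a relation between them produces
  \<open>H, yH, y\<^sup>2H \<in> W\<close>.
\<close>

lemma multiples_of_y_proportional:
  assumes A: "A \<in> W" "pCons 0 A \<in> W" and B: "B \<in> W" "pCons 0 B \<in> W" and "A \<noteq> 0"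
  shows "\<exists>k. B = pscale k A"
proof (rule ccontr)
  assume notprop: "\<not> ?thesis"
  have AB: "c = 0 \<and> d = 0" if "pscale c A + pscale d B = 0" for c d
  proof -
    have "d = 0"
    proof (rule ccontr)
      assume d: "d \<noteq> 0"
      have "pscale d B = pscale (- c) A" using that by (simp add: add_eq_0_iff)
      then have "pscale (1 / d) (pscale d B) = pscale (1 / d) (pscale (- c) A)" by simp
      then have "B = pscale (- c / d) A" using d by simp
      then show False using notprop by blast
    qed
    then show ?thesis using that \<open>A \<noteq> 0\<close> by simp
  qed
  have bidegAB: "bideg_le a (b - 1) A" "bideg_le a (b - 1) B"
    using bideg_le_y_multiple[OF _ bideg_W] A(2) B(2) b by simp_all
  show False
  proof (cases "\<forall>c0 c1 c2 c3. pscale c0 A + pscale c1 (pCons 0 A) + pscale c2 B + pscale c3 (pCons 0 B) = 0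
    \<longrightarrow> c0 = 0 \<and> c1 = 0 \<and> c2 = 0 \<and> c3 = 0")
    case True
    note ind = PP.independent_four[of A "pCons 0 A" B "pCons 0 B", OF True[rule_format]]
    have "T \<subseteq> PP.span {A, pCons 0 A, B, pCons 0 B}"
      using PP.spanned_by_independent_of_full_card[OF ind(1) _ finite_T] A B ind(2) card by simp
    then show False
    proof (rule not_generated_by_two_forms)
      show "0 < a * (b - 1) + a * (b - 1)" using a b by simp
      have b1: "b - (b - 1) = Suc 0" using b by simp
      fix s assume "s \<in> {A, pCons 0 A, B, pCons 0 B}"
      then have "s = [:1:] * A + 0 * B \<or> s = [:0, 1:] * A + 0 * B \<or>
          s = 0 * A + [:1:] * B \<or> s = 0 * A + [:0, 1:] * B" by auto
      moreover have "bideg_le (a - a) (b - (b - 1)) [:1 :: 'k poly:]"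
        "bideg_le (a - a) (b - (b - 1)) [:0, 1 :: 'k poly:]" unfolding b1 by simp_all
      ultimately show "\<exists>e e'. bideg_le (a - a) (b - (b - 1)) e \<and> bideg_le (a - a) (b - (b - 1)) e' \<and>
          s = e * A + e' * B"
        using bideg_le_0 by blast
    qed (use bidegAB in auto)
  next
    case False
    then obtain c0 c1 c2 c3
      where rel: "pscale c0 A + pscale c1 (pCons 0 A) + pscale c2 B + pscale c3 (pCons 0 B) = 0"
        and nz: "\<not> (c0 = 0 \<and> c1 = 0 \<and> c2 = 0 \<and> c3 = 0)" by blast
    \<comment> \<open>The relation says \<open>y H = - (c\<^sub>0 A + c\<^sub>2 B)\<close>. The definition of \<open>H\<close> gives \<open>y H \<in> W\<close>, and this second
      expression for \<open>y H\<close> gives \<open>y\<^sup>2 H \<in> W\<close>, because \<open>W\<close> contains \<open>y A\<close> and \<open>y B\<close>.\<close>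
    define H where "H = pscale c1 A + pscale c3 B"
    have yH: "pCons 0 H = pscale c1 (pCons 0 A) + pscale c3 (pCons 0 B)"
      by (simp add: H_def pscale_def)
    then have yH': "pCons 0 H = pscale (- c0) A + pscale (- c2) B"
      using rel by (simp add: algebra_simps add_eq_0_iff)
    have yyH: "pCons 0 (pCons 0 H) = pscale (- c0) (pCons 0 A) + pscale (- c2) (pCons 0 B)"
      unfolding yH' by (simp add: pscale_def)
    have H0: "H \<noteq> 0"
    proof
      assume "H = 0"
      then have "c1 = 0 \<and> c3 = 0" "- c0 = 0 \<and> - c2 = 0"
        using AB[of c1 c3] AB[of "- c0" "- c2"] yH' by (simp_all add: H_def)
      then show False using nz by simp
    qed
    have W: "H \<in> W" "pCons 0 H \<in> W" "pCons 0 (pCons 0 H) \<in> W"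
      unfolding yyH unfolding yH unfolding H_def
      using A B by (auto intro!: PP.span_add PP.span_diff PP.span_neg PP.span_scale)
    \<comment> \<open>The bound \<open>b - 2\<close> on the degree of \<open>H\<close> in \<open>y\<close> comes for free from \<open>y\<^sup>2 H \<in> W\<close>.\<close>
    obtain b' where b': "b = Suc (Suc b')" using b by (metis Suc_le_D numeral_2_eq_2 Suc_le_mono)
    have bidegH: "bideg_le a b' H" using bideg_W[OF W(3)] by (simp add: b')
    have "c0 = 0 \<and> c1 = 0 \<and> c2 = 0"
      if "pscale c0 H + pscale c1 (pCons 0 H) + pscale c2 (pCons 0 (pCons 0 H)) = 0" for c0 c1 c2
    proof -
      have "[:[:c0:], [:c1:], [:c2:]:] * H = 0" using that by (simp add: pscale_def add.assoc)
      then have "[:[:c0:], [:c1:], [:c2:]:] = 0" using H0 by (metis mult_eq_0_iff)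
      then show ?thesis by simp
    qed
    note ind = PP.independent_three[OF this]
    show False
    proof (rule no_three_multiples[OF ind _ bidegH])
      show "{H, pCons 0 H, pCons 0 (pCons 0 H)} \<subseteq> W" using W by simp
      show "0 < a * b + a * b'" using a b by simp
      fix s assume "s \<in> {H, pCons 0 H, pCons 0 (pCons 0 H)}"
      then have "s = [:1:] * H \<or> s = [:0, 1:] * H \<or> s = [:0, 0, 1:] * H" by auto
      moreover have "bideg_le (a - a) (b - b') [:1 :: 'k poly:]"
        "bideg_le (a - a) (b - b') [:0, 1 :: 'k poly:]"
        "bideg_le (a - a) (b - b') [:0, 0, 1 :: 'k poly:]"
        by (simp_all add: b' Suc_diff_le)
      ultimately show "\<exists>e. bideg_le (a - a) (b - b') e \<and> s = e * H" by blast
    qed (simp_all add: b')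
  qed
qed

text \<open>
  Syzygies of bidegrees \<open>(0,1)\<close> and \<open>(1,0)\<close> exclude each other. A relation between \<open>A, yA, B, xB\<close> has the
  form \<open>m A + l B = 0\<close> with \<open>m \<in> k[y]\<close> and \<open>l \<in> k[x]\<close> linear, hence \<open>A = - l h\<close> and \<open>B = m h\<close>. The space
  spanned by \<open>l, yl, m, xm\<close> has dimension three, which gives three independent multiples of \<open>h\<close>.
\<close>

lemma no_mixed_multiples:
  assumes A: "A \<in> W" "pCons 0 A \<in> W" and B: "B \<in> W" "smult [:0, 1:] B \<in> W"
  shows "A = 0 \<or> B = 0"
proof (rule ccontr)
  assume "\<not> ?thesis"
  then have A0: "A \<noteq> 0" and B0: "B \<noteq> 0" by auto
  have bidegA: "bideg_le a (b - 1) A" using bideg_le_y_multiple[OF _ bideg_W[OF A(2)]] b by simp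
  have bidegB: "bideg_le (a - 1) b B" using bideg_le_x_multiple bideg_W B(2) by blast
  have a1: "a - (a - 1) = Suc 0" "a - 1 \<le> a" and b1: "b - (b - 1) = Suc 0" "b - 1 \<le> b" using a b by simp_all
  show False
  proof (cases "\<forall>c0 c1 c2 c3. pscale c0 A + pscale c1 (pCons 0 A) + pscale c2 B + pscale c3 (smult [:0, 1:] B) = 0
    \<longrightarrow> c0 = 0 \<and> c1 = 0 \<and> c2 = 0 \<and> c3 = 0")
    case True
    note ind = PP.independent_four[of A "pCons 0 A" B "smult [:0, 1:] B", OF True[rule_format]]
    have "T \<subseteq> PP.span {A, pCons 0 A, B, smult [:0, 1:] B}"
      using PP.spanned_by_independent_of_full_card[OF ind(1) _ finite_T] A B ind(2) card by simp
    then show False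
    proof (rule not_generated_by_two_forms[OF _ bidegA order_refl b1(2) bidegB a1(2) order_refl])
      show "0 < a * b + (a - 1) * (b - 1)" using a b by simp
      fix s assume "s \<in> {A, pCons 0 A, B, smult [:0, 1:] B}"
      then have "s = [:1:] * A + 0 * B \<or> s = [:0, 1:] * A + 0 * B \<or>
          s = 0 * A + [:1:] * B \<or> s = 0 * A + [:[:0, 1:]:] * B" by auto
      moreover have "bideg_le (a - a) (b - (b - 1)) [:1 :: 'k poly:]"
        "bideg_le (a - a) (b - (b - 1)) [:0, 1 :: 'k poly:]"
        "bideg_le (a - (a - 1)) (b - b) [:1 :: 'k poly:]"
        "bideg_le (a - (a - 1)) (b - b) [:[:0, 1:] :: 'k poly:]" unfolding a1 b1 by simp_all
      ultimately show "\<exists>e e'. bideg_le (a - a) (b - (b - 1)) e \<and> bideg_le (a - (a - 1)) (b - b) e' \<and>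
          s = e * A + e' * B"
        using bideg_le_0 by blast
    qed
  next
    case False
    then obtain c0 c1 c2 c3
      where rel: "pscale c0 A + pscale c1 (pCons 0 A) + pscale c2 B + pscale c3 (smult [:0, 1:] B) = 0"
        and nz: "\<not> (c0 = 0 \<and> c1 = 0 \<and> c2 = 0 \<and> c3 = 0)" by blast
    define m where "m = [:[:c0:], [:c1:]:]"
    define l where "l = [:c2, c3:]"
    have "smult l B = smult ([:c2:] + [:c3:] * [:0, 1:]) B" by (simp add: l_def)
    also have "\<dots> = pscale c2 B + pscale c3 (smult [:0, 1:] B)"
      unfolding smult_add_left pscale_def smult_smult ..
    finally have "m * A + smult l B = 0" using rel by (simp add: m_def pscale_def add.assoc)
    then have mA: "m * A = - smult l B" by (simp add: add_eq_0_iff)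
    have m0: "m \<noteq> 0"
    proof
      assume "m = 0"
      then have "smult l B = 0" using mA by simp
      then show False using B0 nz \<open>m = 0\<close> by (simp add: l_def m_def)
    qed
    have l0: "l \<noteq> 0" using mA m0 A0 by auto
    have c01: "c0 \<noteq> 0 \<or> c1 \<noteq> 0" using m0 by (auto simp: m_def)
    \<comment> \<open>Either \<open>m\<close> is a unit, or \<open>l(x) B\<close> vanishes at the root of \<open>m\<close> and therefore \<open>B\<close> does.\<close>
    have "\<exists>h. B = m * h"
    proof (cases "c1 = 0")
      case True
      then have "B = m * smult [:1 / c0:] B" using c01 by (simp add: m_def flip: one_pCons)
      then show ?thesis by blast
    next
      case False
      define y where "y = - c0 / c1"
      have my: "m = smult [:c1:] [:- [:y:], 1:]" using False by (simp add: m_def y_def)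
      have "poly (m * A) [:y:] = 0" by (simp add: my mult.commute)
      then have "poly B [:y:] = 0" using l0 by (simp add: mA)
      then obtain h where h: "B = [:- [:y:], 1:] * h" by (auto simp: poly_eq_0_iff_dvd)
      have "m * smult [:1 / c1:] h = smult ([:1 / c1:] * [:c1:]) ([:- [:y:], 1:] * h)"
        by (simp only: my mult_smult_left mult_smult_right smult_smult)
      also have "[:1 / c1:] * [:c1:] = 1" using False by (simp add: one_pCons)
      finally have "B = m * smult [:1 / c1:] h" unfolding h by simp
      then show ?thesis by blast
    qed
    then obtain h where Bh: "B = m * h" by blast
    have "m * A = m * (- smult l h)" using mA by (simp add: Bh)
    then have Ah: "A = - smult l h" using m0 by (metis mult_left_cancel)
    have h0: "h \<noteq> 0" using B0 Bh by auto
    \<comment> \<open>Each degree of \<open>h\<close> is read off from the product with the factor that lacks the variable in question: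
      \<open>l h = - A\<close> bounds the degree in \<open>y\<close>, and \<open>m h = B\<close> the one in \<open>x\<close>.\<close>
    have "degree h \<le> b - 1" using bidegA l0 by (simp add: bideg_le_def Ah)
    moreover have "degree (coeff h j) \<le> a - 1" for j
    proof (rule degree_coeffs_linear_y_factor[OF c01])
      show "degree (coeff ([:[:c0:], [:c1:]:] * h) i) \<le> a - 1" for i
        using bidegB unfolding Bh m_def bideg_le_def by blast
    qed
    ultimately have bidegh: "bideg_le (a - 1) (b - 1) h" by (simp add: bideg_le_def)
    \<comment> \<open>The third of the independent elements is \<open>B\<close> if \<open>l\<close> has degree 1 and \<open>x B\<close> if \<open>l\<close> is a constant;
      \<open>g\<close> is this factor \<open>1\<close> or \<open>x\<close>.\<close>
    have indep3: "e0 = 0 \<and> e1 = 0 \<and> e2 = 0"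
      if "pscale e0 A + pscale e1 (pCons 0 A) + smult (smult e2 g) B = 0"
        and g: "g = 1 \<and> c3 \<noteq> 0 \<or> g = [:0, 1:] \<and> c3 = 0" for e0 e1 e2 g
    proof -
      have neg: "pCons 0 (- f) = - pCons 0 f" for f :: "'k poly poly" by simp
      have "(smult (smult e2 g) m - [:smult e0 l, smult e1 l:]) * h = 0"
        using that(1) by (simp add: Ah Bh pscale_def algebra_simps neg del: minus_pCons)
      then have "smult (smult e2 g) m = [:smult e0 l, smult e1 l:]" using h0 by simp
      then have "smult (e2 * c0) g = smult e0 l" "smult (e2 * c1) g = smult e1 l"
        by (simp_all add: m_def mult.commute)
      then show ?thesis using g l0 c01 by (auto simp: l_def one_pCons)
    qed
    have contra: False
      if g: "g = 1 \<and> c3 \<noteq> 0 \<or> g = [:0, 1:] \<and> c3 = 0" for g :: "'k poly"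
    proof -
      have "pscale e (smult g B) = smult (smult e g) B" for e by (simp add: pscale_def)
      then have "e0 = 0 \<and> e1 = 0 \<and> e2 = 0"
        if "pscale e0 A + pscale e1 (pCons 0 A) + pscale e2 (smult g B) = 0" for e0 e1 e2
        using indep3[OF _ g] that by simp
      note ind = PP.independent_three[OF this]
      show False
      proof (rule no_three_multiples[OF ind _ bidegh a1(2) b1(2)])
        show "{A, pCons 0 A, smult g B} \<subseteq> W" using A B g by auto
        show "0 < (a - 1) * b + a * (b - 1)" using a b by simp
        fix s assume "s \<in> {A, pCons 0 A, smult g B}"
        then have "s = [:- l:] * h \<or> s = [:0, - l:] * h \<or> s = smult g m * h"
          by (auto simp: Ah Bh)
        moreover have "bideg_le (a - (a - 1)) (b - (b - 1)) [:- l:]"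
          "bideg_le (a - (a - 1)) (b - (b - 1)) [:0, - l:]"
          "bideg_le (a - (a - 1)) (b - (b - 1)) (smult g m)"
          unfolding a1 b1 using g by (auto simp: l_def m_def)
        ultimately show "\<exists>e. bideg_le (a - (a - 1)) (b - (b - 1)) e \<and> s = e * h" by blast
      qed
    qed
    show False using contra[of 1] contra[of "[:0, 1:]"] by blast
  qed
qed

end

section \<open>Dehomogenisation\<close>

lemma poly_mapping_additive_induct [case_names single add]:
  fixes P :: "('a \<Rightarrow>\<^sub>0 'b::monoid_add) \<Rightarrow> bool"
  assumes "\<And>k v. P (Poly_Mapping.single k v)" "\<And>f g. P f \<Longrightarrow> P g \<Longrightarrow> P (f + g)"
  shows "P f"
proof (induction f rule: update_induct)
  case const
  show ?case using assms(1)[of _ 0] by simp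
next
  case (update f k v)
  have "Poly_Mapping.update k v f = Poly_Mapping.single k v + f"
    using update(1)
    by (intro poly_mapping_eqI) (auto simp: lookup_update lookup_add lookup_single in_keys_iff when_def)
  then show ?case using assms update(3) by simp
qed

text \<open>
  The variables \<open>e1\<close> and \<open>e2\<close> become \<open>x\<close> and \<open>y\<close>, and the other two are set to 1. Both \<open>(e1, e2) = (Vs, Vu)\<close>
  and \<open>(e1, e2) = (Vu, Vs)\<close> are needed: the second choice exchanges the two factors of \<open>\<P>\<^sup>1 \<times> \<P>\<^sup>1\<close>.
\<close>

definition dehom :: "var \<Rightarrow> var \<Rightarrow> 'k::comm_ring_1 R \<Rightarrow> 'k poly poly"
  where "dehom e1 e2 f = (\<Sum>m\<in>Poly_Mapping.keys f.
    monom (monom (Poly_Mapping.lookup f m) (Poly_Mapping.lookup m e1)) (Poly_Mapping.lookup m e2))"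

lemma dehom_add: "dehom e1 e2 (f + g) = dehom e1 e2 f + dehom e1 e2 g"
  unfolding dehom_def by (rule setsum_keys_plus_distrib) (simp_all add: add_monom)

lemma dehom_single:
  "dehom e1 e2 (Poly_Mapping.single m c) =
    monom (monom c (Poly_Mapping.lookup m e1)) (Poly_Mapping.lookup m e2)"
  by (simp add: dehom_def)

lemma dehom_0 [simp]: "dehom e1 e2 0 = 0"
  by (simp add: dehom_def)

lemma dehom_sum: "dehom e1 e2 (\<Sum>i\<in>I. f i) = (\<Sum>i\<in>I. dehom e1 e2 (f i))"
  by (induction I rule: infinite_finite_induct) (simp_all add: dehom_add)

lemma dehom_mult: "dehom e1 e2 (f * g) = dehom e1 e2 f * dehom e1 e2 g"
proof (induction f rule: poly_mapping_additive_induct)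
  case (single m c)
  show ?case
    by (induction g rule: poly_mapping_additive_induct)
      (simp_all add: mult_single dehom_single dehom_add mult_monom lookup_add distrib_left)
next
  case (add f f')
  then show ?case by (simp add: dehom_add distrib_right)
qed

lemma dehom_scale_R: "dehom e1 e2 (scale_R c f) = pscale c (dehom e1 e2 f)"
  by (simp add: scale_R_def dehom_mult dehom_single pscale_def monom_0)

lemma lookup_scale_R: "Poly_Mapping.lookup (scale_R c f) m = c * Poly_Mapping.lookup f m"
proof (induction f rule: poly_mapping_additive_induct)
  case (single k v)
  show ?case by (simp add: scale_R_def mult_single lookup_single when_def)
next
  case (add f g)
  then show ?case by (simp add: scale_R_simps lookup_add distrib_left)
qed

lemma bideg_le_monom: "i \<le> c \<Longrightarrow> j \<le> d \<Longrightarrow> bideg_le c d (monom (monom k i) j)"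
  by (auto simp: bideg_le_def intro: order_trans[OF degree_monom_le])

lemma bideg_le_sum: "(\<And>i. i \<in> I \<Longrightarrow> bideg_le c d (F i)) \<Longrightarrow> bideg_le c d (\<Sum>i\<in>I. F i)"
  by (induction I rule: infinite_finite_induct) (simp_all add: bideg_le_add)

lemma bideg_le_0_1_cases:
  assumes "bideg_le 0 1 F"
  shows "F = [:[:coeff (coeff F 0) 0:], [:coeff (coeff F 1) 0:]:]"
proof (rule poly_eqI)
  fix j
  have const: "coeff F j = [:coeff (coeff F j) 0:]" for j
    using assms by (metis bideg_le_def degree_eq_zeroE coeff_pCons_0 le_zero_eq)
  show "coeff F j = coeff [:[:coeff (coeff F 0) 0:], [:coeff (coeff F 1) 0:]:] j"
  proof (cases "j \<le> 1")
    case True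
    then show ?thesis using const[of j] by (cases j) simp_all
  next
    case False
    then obtain i where "j = Suc (Suc i)" by (metis One_nat_def not_less_eq_eq le0 not0_implies_Suc Suc_le_mono)
    moreover from this have "coeff F j = 0" using assms by (intro coeff_eq_0) (simp add: bideg_le_def)
    ultimately show ?thesis by simp
  qed
qed

lemma bideg_le_1_0_cases:
  assumes "bideg_le 1 0 F"
  shows "F = [:[:coeff (coeff F 0) 0, coeff (coeff F 0) 1:]:]"
proof -
  obtain f where F: "F = [:f:]" using assms by (metis bideg_le_def degree_eq_zeroE le_zero_eq)
  then have "degree f \<le> 1" using assms by simp
  then have "f = [:coeff f 0, coeff f 1:]" 
    by (intro poly_eqI) (auto simp: coeff_pCons coeff_eq_0 split: nat.split)
  then show ?thesis by (simp add: F)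
qed

text \<open>
  The primed variables are the ones that are set to 1.
\<close>

locale chart =
  fixes e1 e1' e2 e2' :: var
  assumes cover: "UNIV = {e1, e1', e2, e2'}"
begin

definition piece :: "nat \<Rightarrow> nat \<Rightarrow> 'k::comm_ring_1 R set"
  where "piece c d = {f. \<forall>m\<in>Poly_Mapping.keys f.
    Poly_Mapping.lookup m e1 + Poly_Mapping.lookup m e1' = c \<and>
    Poly_Mapping.lookup m e2 + Poly_Mapping.lookup m e2' = d}"

lemma piece_0 [simp]: "0 \<in> piece c d"
  by (simp add: piece_def)

lemma piece_add: "f \<in> piece c d \<Longrightarrow> g \<in> piece c d \<Longrightarrow> f + g \<in> piece c d"
  using keys_add[of f g] by (auto simp: piece_def)

lemma piece_scale_R: "f \<in> piece c d \<Longrightarrow> scale_R k f \<in> piece c d"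
  by (auto simp: piece_def in_keys_iff lookup_scale_R)

lemma piece_sum: "(\<And>i. i \<in> I \<Longrightarrow> f i \<in> piece c d) \<Longrightarrow> (\<Sum>i\<in>I. f i) \<in> piece c d"
  by (induction I rule: infinite_finite_induct) (simp_all add: piece_add)

lemma piece_diff: "f \<in> piece c d \<Longrightarrow> g \<in> piece c d \<Longrightarrow> f - g \<in> piece c d"
  using keys_diff[of f g] by (auto simp: piece_def)

lemma bideg_le_dehom: "f \<in> piece c d \<Longrightarrow> bideg_le c d (dehom e1 e2 f)"
  unfolding dehom_def by (intro bideg_le_sum bideg_le_monom) (auto simp: piece_def)

text \<open>
  On a bigraded piece, the exponents of \<open>e1\<close> and \<open>e2\<close> determine those of the other two variables, so that
  distinct monomials stay distinct.
\<close>

lemma dehom_eq_0_iff: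
  assumes f: "f \<in> piece c d"
  shows "dehom e1 e2 f = 0 \<longleftrightarrow> f = 0"
proof
  assume 0: "dehom e1 e2 f = 0"
  show "f = 0"
  proof (rule ccontr)
    assume "f \<noteq> 0"
    then obtain m where m: "m \<in> Poly_Mapping.keys f" by fastforce
    have eq: "n = m" if n: "n \<in> Poly_Mapping.keys f"
      and same: "Poly_Mapping.lookup n e1 = Poly_Mapping.lookup m e1"
        "Poly_Mapping.lookup n e2 = Poly_Mapping.lookup m e2" for n
    proof (rule poly_mapping_eqI)
      fix v
      have "Poly_Mapping.lookup n e1 + Poly_Mapping.lookup n e1' = c \<and>
          Poly_Mapping.lookup n e2 + Poly_Mapping.lookup n e2' = d \<and>
          Poly_Mapping.lookup m e1 + Poly_Mapping.lookup m e1' = c \<and>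
          Poly_Mapping.lookup m e2 + Poly_Mapping.lookup m e2' = d"
        using f m n by (auto simp: piece_def)
      moreover have "v \<in> {e1, e1', e2, e2'}" using cover by blast
      ultimately show "Poly_Mapping.lookup n v = Poly_Mapping.lookup m v" using same by auto
    qed
    have "0 = coeff (coeff (dehom e1 e2 f) (Poly_Mapping.lookup m e2)) (Poly_Mapping.lookup m e1)"
      by (simp add: 0)
    also have "\<dots> = (\<Sum>n\<in>Poly_Mapping.keys f. if n = m then Poly_Mapping.lookup f n else 0)"
      unfolding dehom_def coeff_sum
      by (intro sum.cong refl) (auto dest: eq)
    also have "\<dots> = Poly_Mapping.lookup f m" using m by simp
    finally show False using m by (simp add: in_keys_iff)
  qed
qed simp

text \<open>
  The value at a point of \<open>\<P>\<^sup>1 \<times> \<P>\<^sup>1\<close> is the value of the original form at the representative \<open>(x : 1)\<close> or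
  \<open>(1 : 0)\<close> in each factor.
\<close>

lemma biform_val_dehom:
  assumes f: "f \<in> piece c d"
  shows "biform_val c d (dehom e1 e2 f) x y = (\<Sum>m\<in>Poly_Mapping.keys f. Poly_Mapping.lookup f m *
    case_option 1 (\<lambda>z. z) x ^ Poly_Mapping.lookup m e1 * case_option 0 (\<lambda>_. 1) x ^ Poly_Mapping.lookup m e1' *
    case_option 1 (\<lambda>z. z) y ^ Poly_Mapping.lookup m e2 * case_option 0 (\<lambda>_. 1) y ^ Poly_Mapping.lookup m e2')"
proof -
  have mon: "form_val n (monom k i) z = k * (case_option 1 (\<lambda>z. z) z ^ i * case_option 0 (\<lambda>_. 1) z ^ j)"
    if "i + j = n" for n i j z and k :: 'a
    using that by (auto simp: form_val_def poly_monom power_0_left split: option.split)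
  show ?thesis
    unfolding dehom_def biform_val_sum
  proof (rule sum.cong[OF refl])
    fix m assume "m \<in> Poly_Mapping.keys f"
    then have m: "Poly_Mapping.lookup m e1 + Poly_Mapping.lookup m e1' = c"
      "Poly_Mapping.lookup m e2 + Poly_Mapping.lookup m e2' = d"
      using f by (auto simp: piece_def)
    show "biform_val c d (monom (monom (Poly_Mapping.lookup f m) (Poly_Mapping.lookup m e1)) (Poly_Mapping.lookup m e2)) x y
      = Poly_Mapping.lookup f m *
    case_option 1 (\<lambda>z. z) x ^ Poly_Mapping.lookup m e1 * case_option 0 (\<lambda>_. 1) x ^ Poly_Mapping.lookup m e1' *
    case_option 1 (\<lambda>z. z) y ^ Poly_Mapping.lookup m e2 * case_option 0 (\<lambda>_. 1) y ^ Poly_Mapping.lookup m e2'"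
      by (simp add: biform_val_def map_poly_monom mon[OF m(1)] mon[OF m(2)] mult.assoc)
  qed
qed

end

section \<open>Linear syzygies\<close>

text \<open>
  The hypotheses of the theorem on \<open>p\<close>, seen in one chart.
\<close>

locale bpf_basis = chart e1 e1' e2 e2' for e1 e1' e2 e2' +
  fixes a b :: nat and p :: "4 \<Rightarrow> 'k::alg_closed_field R"
  assumes a2: "2 \<le> a" and b2: "2 \<le> b" and p: "\<And>i. p i \<in> piece a b"
    and lin: "\<And>c i. (\<Sum>i\<in>UNIV. scale_R (c i) (p i)) = 0 \<Longrightarrow> c i = 0"
    and no_base_point: "\<And>x y. \<exists>i. biform_val a b (dehom e1 e2 (p i)) x y \<noteq> 0"
begin

abbreviation P where "P i \<equiv> dehom e1 e2 (p i)"

definition comb :: "(4 \<Rightarrow> 'k) \<Rightarrow> 'k poly poly"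
  where "comb c = (\<Sum>i\<in>UNIV. pscale (c i) (P i))"

lemma comb_eq_0: "comb c = 0 \<Longrightarrow> c i = 0"
proof -
  assume "comb c = 0"
  then have "dehom e1 e2 (\<Sum>i\<in>UNIV. scale_R (c i) (p i)) = 0"
    by (simp add: comb_def dehom_sum dehom_scale_R)
  moreover have "(\<Sum>i\<in>UNIV. scale_R (c i) (p i)) \<in> piece a b"
    by (intro piece_sum piece_scale_R p)
  ultimately show ?thesis using dehom_eq_0_iff lin by blast
qed

lemma comb_scale: "comb (\<lambda>i. k * c i) = pscale k (comb c)"
  by (simp add: comb_def PP.scale_sum_right)

lemma comb_diff: "comb (\<lambda>i. c i - d i) = comb c - comb d"
  by (simp add: comb_def PP.scale_left_diff_distrib sum_subtractf)

lemma comb_inj: "comb c = comb d \<Longrightarrow> c i = d i"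
  using comb_eq_0[of "\<lambda>i. c i - d i" i] by (simp add: comb_diff)

sublocale bpf_quadruple a b "range P"
proof
  have rel: "\<forall>i\<in>UNIV. c i = 0" if "(\<Sum>i\<in>UNIV. pscale (c i) (P i)) = 0" for c
    using comb_eq_0[of c] that by (simp add: comb_def)
  note fam = PP.independent_family[of UNIV P, OF finite rel]
  show "PP.independent (range P)" using fam(2) .
  show "card (range P) = 4" using card_image[OF fam(1)] by simp
  show "bideg_le a b t" if "t \<in> range P" for t using that bideg_le_dehom p by blast
  show "\<exists>t\<in>range P. biform_val a b t x y \<noteq> 0" for x y using no_base_point by blast
qed (use a2 b2 in auto)

lemma comb_in_W: "comb c \<in> W"
  unfolding comb_def by (intro PP.span_sum PP.span_scale PP.span_base) simp

lemma dehom_syzygy: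
  assumes "g \<in> Syz p"
  shows "(\<Sum>i\<in>UNIV. dehom e1 e2 (vec_nth g i) * P i) = 0"
proof -
  have "dehom e1 e2 (\<Sum>i\<in>UNIV. vec_nth g i * p i) = 0" using assms by (simp add: Syz_def)
  then show ?thesis by (simp add: dehom_sum dehom_mult)
qed

text \<open>
  The translation of syzygies of bidegree \<open>(0,1)\<close>: with \<open>A = comb al\<close>, the syzygy equation is
  \<open>y A = - comb be\<close>, so that \<open>A\<close> and \<open>y A\<close> both lie in \<open>W\<close>.
\<close>

lemma y_syzygy:
  assumes g: "g \<in> Syz p" "\<And>i. vec_nth g i \<in> piece 0 1"
  obtains al be where "\<And>i. dehom e1 e2 (vec_nth g i) = [:[:be i:], [:al i:]:]"
    "pCons 0 (comb al) = - comb be"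
proof -
  define al where "al i = coeff (coeff (dehom e1 e2 (vec_nth g i)) 1) 0" for i
  define be where "be i = coeff (coeff (dehom e1 e2 (vec_nth g i)) 0) 0" for i
  have eq: "dehom e1 e2 (vec_nth g i) = [:[:be i:], [:al i:]:]" for i
    unfolding al_def be_def by (rule bideg_le_0_1_cases[OF bideg_le_dehom[OF g(2)]])
  have "dehom e1 e2 (vec_nth g i) * P i = pscale (be i) (P i) + [:0, 1:] * pscale (al i) (P i)" for i
    unfolding eq by (simp add: pscale_def)
  then have "0 = (\<Sum>i\<in>UNIV. pscale (be i) (P i) + [:0, 1:] * pscale (al i) (P i))"
    using dehom_syzygy[OF g(1)] by (simp only:)
  also have "\<dots> = comb be + [:0, 1:] * comb al"
    by (simp only: sum.distrib comb_def sum_distrib_left)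
  finally have "comb be + [:0, 1:] * comb al = 0" by (rule sym)
  then have "pCons 0 (comb al) = - comb be" by (simp add: add_eq_0_iff)
  with eq show thesis by (rule that)
qed

lemma x_syzygy:
  assumes g: "g \<in> Syz p" "\<And>i. vec_nth g i \<in> piece 1 0"
  obtains al be where "\<And>i. dehom e1 e2 (vec_nth g i) = [:[:be i, al i:]:]"
    "smult [:0, 1:] (comb al) = - comb be"
proof -
  define al where "al i = coeff (coeff (dehom e1 e2 (vec_nth g i)) 0) 1" for i
  define be where "be i = coeff (coeff (dehom e1 e2 (vec_nth g i)) 0) 0" for i
  have eq: "dehom e1 e2 (vec_nth g i) = [:[:be i, al i:]:]" for i
    unfolding al_def be_def by (rule bideg_le_1_0_cases[OF bideg_le_dehom[OF g(2)]])
  have split: "[:[:s, t:]:] * F = pscale s F + [:[:0, 1:]:] * pscale t F" for s t and F :: "'k poly poly"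
    by (simp add: pscale_def smult_add_left[symmetric])
  have "dehom e1 e2 (vec_nth g i) * P i = pscale (be i) (P i) + [:[:0, 1:]:] * pscale (al i) (P i)" for i
    unfolding eq by (rule split)
  then have "0 = (\<Sum>i\<in>UNIV. pscale (be i) (P i) + [:[:0, 1:]:] * pscale (al i) (P i))"
    using dehom_syzygy[OF g(1)] by (simp only:)
  also have "\<dots> = comb be + [:[:0, 1:]:] * comb al"
    by (simp only: sum.distrib comb_def sum_distrib_left)
  finally have "comb be + [:[:0, 1:]:] * comb al = 0" by (rule sym)
  then have "smult [:0, 1:] (comb al) = - comb be" by (simp add: add_eq_0_iff)
  with eq show thesis by (rule that)
qed

text \<open>
  The syzygy can be recovered from \<open>A\<close>: independence of \<open>p\<close> gives \<open>al\<close> from \<open>A\<close> and \<open>be\<close> from \<open>y A\<close>.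
  Proportional elements of \<open>W\<close> therefore come from proportional syzygies.
\<close>

lemma y_syzygy_unique:
  assumes g: "g \<in> Syz p" "\<And>i. vec_nth g i \<in> piece 0 1" "g \<noteq> 0"
    and h: "h \<in> Syz p" "\<And>i. vec_nth h i \<in> piece 0 1"
  shows "\<exists>k. h = scale_R4 k g"
proof -
  obtain al be where G: "\<And>i. dehom e1 e2 (vec_nth g i) = [:[:be i:], [:al i:]:]"
    "pCons 0 (comb al) = - comb be" using y_syzygy[OF g(1,2)] by blast
  obtain al' be' where H: "\<And>i. dehom e1 e2 (vec_nth h i) = [:[:be' i:], [:al' i:]:]"
    "pCons 0 (comb al') = - comb be'" using y_syzygy[OF h] by blast
  have "comb al \<noteq> 0"
  proof
    assume 0: "comb al = 0"
    then have "comb be = 0" using G(2) by simp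
    then have "dehom e1 e2 (vec_nth g i) = 0" for i
      using G(1) comb_eq_0[OF 0] comb_eq_0[of be] by simp
    then have "g = 0" using dehom_eq_0_iff[OF g(2)] by (simp add: Finite_Cartesian_Product.vec_eq_iff)
    then show False using g(3) by simp
  qed
  moreover have "pCons 0 (comb al) \<in> W" "pCons 0 (comb al') \<in> W"
    unfolding G(2) H(2) by (intro PP.span_neg comb_in_W)+
  ultimately obtain k where k: "comb al' = pscale k (comb al)"
    using multiples_of_y_proportional comb_in_W by blast
  have al': "al' i = k * al i" for i
    using k comb_inj[of al' "\<lambda>i. k * al i"] by (simp add: comb_scale)
  have "comb be' = - pCons 0 (pscale k (comb al))" using H(2) k by simp
  also have "\<dots> = - pscale k (pCons 0 (comb al))" by (simp add: pscale_def)
  also have "\<dots> = comb (\<lambda>i. k * be i)" by (simp add: G(2) comb_scale)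
  finally have be': "be' i = k * be i" for i by (rule comb_inj)
  have "vec_nth h i - scale_R k (vec_nth g i) = 0" for i
  proof -
    have "dehom e1 e2 (vec_nth h i) = dehom e1 e2 (scale_R k (vec_nth g i))"
      by (simp add: dehom_scale_R G(1) H(1) al' be' pscale_def)
    moreover have "dehom e1 e2 (vec_nth h i - scale_R k (vec_nth g i)) =
        dehom e1 e2 (vec_nth h i) - dehom e1 e2 (scale_R k (vec_nth g i))"
      using dehom_add[of e1 e2 "vec_nth h i - scale_R k (vec_nth g i)" "scale_R k (vec_nth g i)"] by simp
    ultimately show ?thesis
      using dehom_eq_0_iff[OF piece_diff[OF h(2) piece_scale_R[OF g(2)]]] by simp
  qed
  then have "h = scale_R4 k g" by (simp add: Finite_Cartesian_Product.vec_eq_iff scale_R4_def)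
  then show ?thesis ..
qed

lemma no_mixed_syzygies:
  assumes g: "g \<in> Syz p" "\<And>i. vec_nth g i \<in> piece 0 1"
    and h: "h \<in> Syz p" "\<And>i. vec_nth h i \<in> piece 1 0"
  shows "g = 0 \<or> h = 0"
proof -
  obtain al be where G: "\<And>i. dehom e1 e2 (vec_nth g i) = [:[:be i:], [:al i:]:]"
    "pCons 0 (comb al) = - comb be" using y_syzygy[OF g] by blast
  obtain al' be' where H: "\<And>i. dehom e1 e2 (vec_nth h i) = [:[:be' i, al' i:]:]"
    "smult [:0, 1:] (comb al') = - comb be'" using x_syzygy[OF h] by blast
  have "pCons 0 (comb al) \<in> W" "smult [:0, 1:] (comb al') \<in> W"
    unfolding G(2) H(2) by (intro PP.span_neg comb_in_W)+
  then consider "comb al = 0" | "comb al' = 0"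
    using no_mixed_multiples comb_in_W by blast
  then show ?thesis
  proof cases
    case 1
    then have "comb be = 0" using G(2) by simp
    then have "dehom e1 e2 (vec_nth g i) = 0" for i
      using G(1) comb_eq_0[OF 1] comb_eq_0[of be] by simp
    then show ?thesis using dehom_eq_0_iff[OF g(2)] by (simp add: Finite_Cartesian_Product.vec_eq_iff)
  next
    case 2
    then have "comb be' = 0" using H(2) by simp
    then have "dehom e1 e2 (vec_nth h i) = 0" for i
      using H(1) comb_eq_0[OF 2] comb_eq_0[of be'] by simp
    then show ?thesis using dehom_eq_0_iff[OF h(2)] by (simp add: Finite_Cartesian_Product.vec_eq_iff)
  qed
qed

end

theorem theorem2p1:
  fixes a b :: nat
    and U :: "('k::alg_closed_field) R set"
    and p :: "4 \<Rightarrow> 'k R"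
  assumes "a \<ge> 2" and "b \<ge> 2"
    and "VR.subspace U" and "U \<subseteq> bigraded_piece a b" and "VR.dim U = 4"
    and "inj p" and "VR.independent (range p)" and "VR.span (range p) = U"
    and "basepoint_free p"
  shows "(\<forall>g h. linear_first_syzygy p g \<and> linear_first_syzygy p h \<longrightarrow>
            (\<exists>c. c \<noteq> 0 \<and> h = scale_R4 c g))
       \<and> VR4.dim (Syz_bideg p 0 1) + VR4.dim (Syz_bideg p 1 0) \<le> 1"
proof -
  have pU: "p i \<in> bigraded_piece a b" for i
    using assms(4,8) VR.span_base by blast
  have lin: "c i = 0" if "(\<Sum>i\<in>UNIV. scale_R (c i) (p i)) = 0" for c i
  proof -
    have "(\<Sum>v\<in>range p. scale_R (c (inv_into UNIV p v)) v) = 0"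
      using that by (simp add: sum.reindex[OF assms(6)] assms(6))
    then have "c (inv_into UNIV p (p i)) = 0"
      using VR.independentD[OF assms(7) finite_imageI[OF finite] subset_refl,
          of "\<lambda>v. c (inv_into UNIV p v)" "p i"] by simp
    then show ?thesis using assms(6) by simp
  qed
  interpret st: chart Vs Vt Vu Vv
    by unfold_locales (auto intro: var.exhaust)
  interpret uv: chart Vu Vv Vs Vt
    by unfold_locales (auto intro: var.exhaust)
  have st_piece: "st.piece c d = bigraded_piece c d" for c d
    by (simp add: st.piece_def bigraded_piece_def)
  have uv_piece: "uv.piece c d = bigraded_piece d c" for c d
    by (auto simp: uv.piece_def bigraded_piece_def)
  define num where "num x = (case x of None \<Rightarrow> 1 | Some z \<Rightarrow> z)" for x :: "'k option"
  define den where "den x = (case x of None \<Rightarrow> 0 :: 'k | Some z \<Rightarrow> 1)" for x :: "'k option"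
  have "(num x, den x) \<noteq> (0, 0)" for x by (simp add: num_def den_def split: option.split)
  then have bpf: "\<exists>i. eval_R (p i) (num x) (den x) (num y) (den y) \<noteq> 0" for x y
    using assms(9) unfolding basepoint_free_def by blast
  have st_val: "biform_val a b (dehom Vs Vu (p i)) x y = eval_R (p i) (num x) (den x) (num y) (den y)"
    for i x y
    using pU by (simp add: st.biform_val_dehom st_piece eval_R_def num_def den_def)
  have uv_val: "biform_val b a (dehom Vu Vs (p i)) y x = eval_R (p i) (num x) (den x) (num y) (den y)"
    for i x y
    using pU by (simp add: uv.biform_val_dehom uv_piece eval_R_def num_def den_def mult_ac)
  interpret st: bpf_basis Vs Vt Vu Vv a b p
    using assms(1,2) pU lin bpf by unfold_locales (simp_all add: st_piece st_val)
  interpret uv: bpf_basis Vu Vv Vs Vt b a p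
    using assms(1,2) pU lin bpf by unfold_locales (simp_all add: uv_piece uv_val)
  have same01: "\<exists>k. h = scale_R4 k g"
    if "g \<in> Syz_bideg p 0 1" "h \<in> Syz_bideg p 0 1" "g \<noteq> 0" for g h
    using that st.y_syzygy_unique[of g h] by (simp add: Syz_bideg_def st_piece)
  have same10: "\<exists>k. h = scale_R4 k g"
    if "g \<in> Syz_bideg p 1 0" "h \<in> Syz_bideg p 1 0" "g \<noteq> 0" for g h
    using that uv.y_syzygy_unique[of g h] by (simp add: Syz_bideg_def uv_piece)
  have mixed: "g = 0 \<or> h = 0" if "g \<in> Syz_bideg p 0 1" "h \<in> Syz_bideg p 1 0" for g h
    using that st.no_mixed_syzygies[of g h] by (simp add: Syz_bideg_def st_piece)
  have proportional: "\<exists>c. c \<noteq> 0 \<and> h = scale_R4 c g"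
    if lin_gh: "linear_first_syzygy p g" "linear_first_syzygy p h" for g h
  proof -
    have "g \<noteq> 0" "h \<noteq> 0" using lin_gh by (auto simp: linear_first_syzygy_def)
    then obtain k where k: "h = scale_R4 k g"
      using lin_gh same01 same10 mixed unfolding linear_first_syzygy_def by blast
    then have "k \<noteq> 0" using \<open>h \<noteq> 0\<close> by auto
    then show ?thesis using k by blast
  qed
  moreover have "VR4.dim (Syz_bideg p 0 1) + VR4.dim (Syz_bideg p 1 0) \<le> 1"
  proof -
    have dim0: "VR4.dim S = 0" if "S \<subseteq> {0}" for S :: "('k R ^ 4) set"
      using VR4.dim_le_card[of S "{}"] that by simp
    have dim1: "VR4.dim S \<le> 1"
      if "\<And>g h. g \<in> S \<Longrightarrow> h \<in> S \<Longrightarrow> g \<noteq> 0 \<Longrightarrow> \<exists>k. h = scale_R4 k g" for S :: "('k R ^ 4) set"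
    proof (cases "S \<subseteq> {0}")
      case True
      then show ?thesis using dim0 by simp
    next
      case False
      then obtain g where "g \<in> S" "g \<noteq> 0" by blast
      then have "S \<subseteq> range (\<lambda>k. scale_R4 k g)" using that by blast
      then have "S \<subseteq> VR4.span {g}" by (simp add: VR4.span_singleton)
      then show ?thesis using VR4.dim_le_card[of S "{g}"] by simp
    qed
    have "Syz_bideg p 0 1 \<subseteq> {0} \<or> Syz_bideg p 1 0 \<subseteq> {0}" using mixed by blast
    then show ?thesis
      using dim0[of "Syz_bideg p 0 1"] dim0[of "Syz_bideg p 1 0"]
        dim1[of "Syz_bideg p 0 1", OF same01] dim1[of "Syz_bideg p 1 0", OF same10] by auto
  qed
  ultimately show ?thesis by (simp add: proportional)
qed

end
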